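(* Let $j$ be a positive integer and let $X$ be the metric completion of the metric space $(V,d)$ (constructed from $j$ as in the context). Then $X$ admits a conical bicombing $\sigma$ and there is a finite subset $A\subset X$ consisting of $j$ points such that $\sigma\text{-}\mathrm{conv}(A)=X$. Moreover, $X$ is non-compact for every $j>1$.
   Context: Construction of $(V,d)$. Fix a positive integer $j$ and let $V_0=\{0,\ldots,j-1\}$, whose elements are regarded as $j$ distinct atoms (ur-elements, not sets). Let $d_0$ be the discrete metric on $V_0$ ($d_0(x,y)=1$ if $x\ne y$, and $0$ otherwise). For any $a,b$ put $m(a,b)=\{a,b\}$ if $a\neq b$ and $m(a,b)=a$ if $a=b$. For $n>0$ define recursively $V_n=\{m(a,b):a,b\in V_{n-1}\}$. Then $V_0\subset V_1\subset V_2\subset\cdots$; let $V=\bigcup_{n\ge0}V_n$. Every $x\in V\setminus V_0$ can be written as $x=m(a,b)$ with distinct $a,b\in V$, unique up to order, called the parents of $x$. The function $d\colon V\times V\to\mathbb{R}$ is defined recursively by: (1) if $x,y\in V_0$, then $d(x,y)=d_0(x,y)$; (2) if $x\in V_0$ and $y\in V\setminus V_0$ has parents $c,e$, then $d(x,y)=d(y,x)=\frac12\big(d(x,c)+d(x,e)\big)$; (3) if $x,y\in V\setminus V_0$ have parents $a,b$ and $c,e$, respectively, then $d(x,y)=\frac12\min\{d(x,c)+d(x,e),\ d(y,a)+d(y,b),\ d(a,c)+d(b,e),\ d(a,e)+d(b,c)\}$. This $d$ is a well-defined metric on $V$. Bicombings. A geodesic in a metric space $(X,d)$ is a map $c\colon[0,1]\to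 X$ with $d(c(s),c(t))=|s-t|\,d(c(0),c(1))$ for all $s,t$. A (geodesic) bicombing on $X$ is a map $\sigma\colon X\times X\times[0,1]\to X$ such that for all $x,y\in X$ the path $\sigma_{xy}(t)=\sigma(x,y,t)$ is a geodesic with $\sigma_{xy}(0)=x$, $\sigma_{xy}(1)=y$. It is conical if $d(\sigma_{xy}(t),\sigma_{x'y'}(t))\le(1-t)\,d(x,x')+t\,d(y,y')$ for all $x,y,x',y'\in X$, $t\in[0,1]$. A subset $C\subset X$ is $\sigma$-convex if $\sigma_{xy}([0,1])\subset C$ for all $x,y\in C$. For $A\subset X$, $\sigma\text{-}\mathrm{conv}(A)$ is the intersection of all closed $\sigma$-convex subsets of $X$ containing $A$. *)

theory Defs
  imports "HOL-Analysis.Analysis" "HOL-Library.FSet"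
begin

text \<open>Hereditarily finite sets over the ur-elements \<open>Atom i\<close>.\<close>

datatype elt = Atom nat | Hset "elt fset"

definition mpair :: "elt \<Rightarrow> elt \<Rightarrow> elt" where
  "mpair a b = (if a = b then a else Hset {|a, b|})"

primrec V_stage :: "nat \<Rightarrow> nat \<Rightarrow> elt set" where
  "V_stage j 0 = Atom ` {0..<j}"
| "V_stage j (Suc n) = {mpair a b | a b. a \<in> V_stage j n \<and> b \<in> V_stage j n}"

definition V_space :: "nat \<Rightarrow> elt set" where
  "V_space j = (\<Union>n. V_stage j n)"

definition atom_or_pair :: "elt \<Rightarrow> bool" where
  "atom_or_pair x \<longleftrightarrow> (\<exists>i. x = Atom i) \<or> (\<exists>a b. a \<noteq> b \<and> x = Hset {|a, b|})"

text \<open>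
  Recursion over unordered pairs of parents: the compatibility obligations show that the
  right-hand sides do not depend on the order of the parents. The last equation is only a
  totalisation; every element of \<open>V_space j\<close> satisfies \<^const>\<open>atom_or_pair\<close>.
\<close>

function V_dist :: "elt \<Rightarrow> elt \<Rightarrow> real" where
  "V_dist (Atom i) (Atom k) = (if i \<noteq> k then 1 else 0)"
| "c \<noteq> e \<Longrightarrow> V_dist (Atom i) (Hset {|c, e|}) = (V_dist (Atom i) c + V_dist (Atom i) e) / 2"
| "c \<noteq> e \<Longrightarrow> V_dist (Hset {|c, e|}) (Atom i) = (V_dist (Atom i) c + V_dist (Atom i) e) / 2"
| "a \<noteq> b \<Longrightarrow> c \<noteq> e \<Longrightarrow> V_dist (Hset {|a, b|}) (Hset {|c, e|}) =
     Min {V_dist (Hset {|a, b|}) c + V_dist (Hset {|a, b|}) e,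
          V_dist (Hset {|c, e|}) a + V_dist (Hset {|c, e|}) b,
          V_dist a c + V_dist b e,
          V_dist a e + V_dist b c} / 2"
| "\<not> atom_or_pair x \<or> \<not> atom_or_pair y \<Longrightarrow> V_dist x y = 0"
proof goal_cases
  case (1 P x)
  obtain u v where x: "x = (u, v)" by (cases x)
  show ?case
  proof (cases "atom_or_pair u \<and> atom_or_pair v")
    case True
    then show ?thesis using 1(1-4) unfolding x atom_or_pair_def by blast
  next
    case False
    then show ?thesis using 1(5) x by blast
  qed
next
  case 14
  then show ?case
    by (auto simp: fdoubleton_eq_iff add.commute finsert_commute insert_commute)
qed (auto simp: fdoubleton_eq_iff add.commute atom_or_pair_def)
termination
  by (relation "inv_image less_than (\<lambda>(x, y). size x + size y)") auto

declare V_dist.simps(5) [simp del]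

lemma V_stage_cases:
  assumes "x \<in> V_stage j n"
  shows "(\<exists>i<j. x = Atom i) \<or>
    (\<exists>a b. a \<noteq> b \<and> x = Hset {|a, b|} \<and> a \<in> V_space j \<and> b \<in> V_space j)"
  using assms
proof (induction n arbitrary: x)
  case 0
  then show ?case by auto
next
  case (Suc n)
  then obtain a b where "x = mpair a b" "a \<in> V_stage j n" "b \<in> V_stage j n" by auto
  moreover from this have "a \<in> V_space j" "b \<in> V_space j" unfolding V_space_def by blast+
  ultimately show ?case
    using Suc.IH unfolding mpair_def by (cases "a = b") (simp, auto)
qed

lemma V_space_cases:
  assumes "x \<in> V_space j"
  obtains (atom) i where "i < j" "x = Atom i"
  | (pair) a b where "a \<noteq> b" "x = Hset {|a, b|}" "a \<in> V_space j" "b \<in> V_space j"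
proof -
  obtain n where "x \<in> V_stage j n" using assms by (auto simp: V_space_def)
  from V_stage_cases[OF this] show thesis using atom pair by blast
qed

lemma V_space_atom_or_pair: "x \<in> V_space j \<Longrightarrow> atom_or_pair x"
  by (erule V_space_cases) (auto simp: atom_or_pair_def)

lemma V_dist_commute: "V_dist x y = V_dist y x"
proof (induction x y rule: V_dist.induct)
  case (4 a b c e)
  then show ?case
    by (simp add: insert_commute add.commute)
qed (auto simp: V_dist.simps(5))

lemma V_dist_nonneg: "0 \<le> V_dist x y"
  by (induction x y rule: V_dist.induct) (auto simp: V_dist.simps(5))

lemma V_dist_self: "V_dist x x = 0"
proof (induction x)
  case (Hset F)
  show ?case
  proof (cases "atom_or_pair (Hset F)")
    case True
    then obtain a b where ab: "a \<noteq> b" "F = {|a, b|}" by (auto simp: atom_or_pair_def)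
    with Hset have "V_dist a a = 0" "V_dist b b = 0" by auto
    then show ?thesis
      using ab V_dist_nonneg[of a b] V_dist_nonneg[of b a] V_dist_nonneg[of "Hset {|a, b|}" a]
        V_dist_nonneg[of "Hset {|a, b|}" b] by (simp add: min_def)
  qed (simp add: V_dist.simps(5))
qed auto

lemma size_pair: "c \<noteq> e \<Longrightarrow> size (Hset {|c, e|}) = Suc (Suc (Suc (size c + size e)))"
  by simp

lemma V_dist_zero:
  assumes "V_dist x y = 0" "x \<in> V_space j" "y \<in> V_space j"
  shows "x = y"
  using assms
proof (induction "size x + size y" arbitrary: x y rule: less_induct)
  case less
  have IH: "u = v"
    if "V_dist u v + r = 0" "0 \<le> r" "u \<in> V_space j" "v \<in> V_space j"
      "size u + size v < size x + size y" for u v r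
    using less.hyps[OF that(5) _ that(3,4)] that(1,2) V_dist_nonneg[of u v] by linarith
  have split: False
    if "c \<noteq> e" "V_dist u c + V_dist u e = 0" "u \<in> V_space j" "c \<in> V_space j" "e \<in> V_space j"
      "size u + size c < size x + size y" "size u + size e < size x + size y" for u c e
  proof -
    have "u = c" using IH[OF that(2)] that(3-7) V_dist_nonneg by simp
    moreover have "u = e" using IH[of u e "V_dist u c"] that(2-7) V_dist_nonneg by simp
    ultimately show False using that(1) by simp
  qed
  from less.prems(2) show ?case
  proof (cases rule: V_space_cases)
    case x: (atom i)
    from less.prems(3) show ?thesis
    proof (cases rule: V_space_cases)
      case (atom k)
      then show ?thesis using x less.prems(1) by (simp split: if_splits)
    next
      case y: (pair c e)
      have "V_dist x c + V_dist x e = 0" using less.prems(1) x y(1,2) by simp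
      then show ?thesis using split[OF y(1) _ less.prems(2) y(3,4)] y(2) size_pair[OF y(1)] by simp
    qed
  next
    case x: (pair a b)
    from less.prems(3) show ?thesis
    proof (cases rule: V_space_cases)
      case y: (atom k)
      have "V_dist y a + V_dist y b = 0" using less.prems(1) y x(1,2) by simp
      then show ?thesis using split[OF x(1) _ less.prems(3) x(3,4)] x(2) size_pair[OF x(1)] by simp
    next
      case y: (pair c e)
      have size: "size x = Suc (Suc (Suc (size a + size b)))" "size y = Suc (Suc (Suc (size c + size e)))"
        using x(2) y(2) size_pair[OF x(1)] size_pair[OF y(1)] by simp_all
      have "Min {V_dist x c + V_dist x e, V_dist y a + V_dist y b,
          V_dist a c + V_dist b e, V_dist a e + V_dist b c} = 0" (is "Min ?S = 0")
        using less.prems(1) V_dist.simps(4)[OF x(1) y(1)] x(2) y(2) by simp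
      moreover have "Min ?S \<in> ?S" by (intro Min_in) auto
      ultimately consider "V_dist x c + V_dist x e = 0" | "V_dist y a + V_dist y b = 0"
        | "V_dist a c + V_dist b e = 0" | "V_dist a e + V_dist b c = 0" by auto
      then show ?thesis
      proof cases
        case 1
        then show ?thesis using split[OF y(1) _ less.prems(2) y(3,4)] size by simp
      next
        case 2
        then show ?thesis using split[OF x(1) _ less.prems(3) x(3,4)] size by simp
      next
        case 3
        have "a = c" using IH[OF 3] x(3) y(3) size V_dist_nonneg by simp
        moreover have "b = e" using IH[of b e "V_dist a c"] 3 x(4) y(4) size V_dist_nonneg by simp
        ultimately show ?thesis using x(2) y(2) by simp
      next
        case 4
        have "a = e" using IH[OF 4] x(3) y(4) size V_dist_nonneg by simp
        moreover have "b = c" using IH[of b c "V_dist a e"] 4 x(4) y(3) size V_dist_nonneg by simp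
        ultimately show ?thesis using x(2) y(2) by (simp add: finsert_commute)
      qed
    qed
  qed
qed

lemma V_dist_le_split:
  assumes "x \<in> V_space j" "c \<noteq> e"
  shows "V_dist x (Hset {|c, e|}) \<le> (V_dist x c + V_dist x e) / 2"
  using assms(1)
proof (cases rule: V_space_cases)
  case (atom i)
  then show ?thesis using assms(2) by simp
next
  case (pair a b)
  show ?thesis
    unfolding pair(2) V_dist.simps(4)[OF pair(1) assms(2)]
    by (intro divide_right_mono Min_le) auto
qed

lemma V_dist_le_match:
  assumes "a \<noteq> b" "c \<noteq> e"
  shows "V_dist (Hset {|a, b|}) (Hset {|c, e|}) \<le> (V_dist a c + V_dist b e) / 2"
  unfolding V_dist.simps(4)[OF assms] by (intro divide_right_mono Min_le) auto

lemma V_dist_cases: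
  assumes "x \<in> V_space j" "y \<in> V_space j"
  obtains (atom) i k where "x = Atom i" "y = Atom k"
  | (split_right) c e where "c \<noteq> e" "y = Hset {|c, e|}" "c \<in> V_space j" "e \<in> V_space j"
      "V_dist x y = (V_dist x c + V_dist x e) / 2"
  | (split_left) a b where "a \<noteq> b" "x = Hset {|a, b|}" "a \<in> V_space j" "b \<in> V_space j"
      "V_dist x y = (V_dist a y + V_dist b y) / 2"
  | (match) a b c e where "a \<noteq> b" "x = Hset {|a, b|}" "a \<in> V_space j" "b \<in> V_space j"
      "c \<noteq> e" "y = Hset {|c, e|}" "c \<in> V_space j" "e \<in> V_space j"
      "V_dist x y = (V_dist a c + V_dist b e) / 2"
  using assms(1)
proof (cases rule: V_space_cases)
  case x: (atom i)
  from assms(2) show thesis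
  proof (cases rule: V_space_cases)
    case (atom k)
    then show thesis using x that(1) by blast
  next
    case (pair c e)
    then show thesis using x that(2)[of c e] by simp
  qed
next
  case x: (pair a b)
  from assms(2) show thesis
  proof (cases rule: V_space_cases)
    case (atom k)
    then show thesis using x that(3)[of a b] V_dist_commute by simp
  next
    case y: (pair c e)
    have "2 * V_dist x y = Min {V_dist x c + V_dist x e, V_dist y a + V_dist y b,
        V_dist a c + V_dist b e, V_dist a e + V_dist b c}" (is "_ = Min ?S")
      using V_dist.simps(4)[OF x(1) y(1)] x(2) y(2) by simp
    moreover have "Min ?S \<in> ?S" by (intro Min_in) auto
    ultimately have "2 * V_dist x y \<in> ?S" by simp
    then consider "2 * V_dist x y = V_dist x c + V_dist x e"
      | "2 * V_dist x y = V_dist y a + V_dist y b"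
      | "2 * V_dist x y = V_dist a c + V_dist b e"
      | "2 * V_dist x y = V_dist a e + V_dist b c"
      by blast
    then show thesis
    proof cases
      case 1
      show thesis by (rule that(2)[OF y]) (use 1 in \<open>simp add: field_simps\<close>)
    next
      case 2
      show thesis
        by (rule that(3)[OF x]) (use 2 V_dist_commute[of y a] V_dist_commute[of y b] in \<open>simp add: field_simps\<close>)
    next
      case 3
      show thesis by (rule that(4)[OF x y]) (use 3 in \<open>simp add: field_simps\<close>)
    next
      case 4
      have "y = Hset {|e, c|}" using y(2) by (simp add: finsert_commute)
      then show thesis by (rule that(4)[OF x y(1)[symmetric] _ y(4,3)]) (use 4 in \<open>simp add: field_simps\<close>)
    qed
  qed
qed

lemma V_dist_triangle:
  assumes "x \<in> V_space j" "y \<in> V_space j" "z \<in> V_space j"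
  shows "V_dist x z \<le> V_dist x y + V_dist y z"
  using assms
proof (induction "size x + size y + size z" arbitrary: x y z rule: less_induct)
  case less
  note V = less.prems and IH = less.hyps
  note le_right = V_dist_le_split and le_match = V_dist_le_match
  have le_left: "V_dist (Hset {|a, b|}) u \<le> (V_dist a u + V_dist b u) / 2"
    if "a \<noteq> b" "u \<in> V_space j" for a b u
    using le_right[OF that(2,1)] V_dist_commute by metis
  from V(1,2) show ?case
  proof (cases rule: V_dist_cases)
    case xy: (split_left a b)
    have "V_dist x z \<le> (V_dist a z + V_dist b z) / 2" using le_left xy V by simp
    moreover have "V_dist a z \<le> V_dist a y + V_dist y z" "V_dist b z \<le> V_dist b y + V_dist y z"
      using IH[of a y z] IH[of b y z] V xy by auto
    ultimately show ?thesis using xy(5) by (simp add: field_simps)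
  next
    case xy: (atom i k)
    from V(2,3) show ?thesis
    proof (cases rule: V_dist_cases)
      case (atom l n)
      then show ?thesis using xy by auto
    next
      case yz: (split_right f g)
      have "V_dist x z \<le> (V_dist x f + V_dist x g) / 2" using le_right yz V by simp
      moreover have "V_dist x f \<le> V_dist x y + V_dist y f" "V_dist x g \<le> V_dist x y + V_dist y g"
        using IH[of x y f] IH[of x y g] V yz by auto
      ultimately show ?thesis using yz(5) by (simp add: field_simps)
    qed (use xy in auto)
  next
    case xy: (split_right c e)
    from V(2,3) show ?thesis
    proof (cases rule: V_dist_cases)
      case (atom l n)
      then show ?thesis using xy by auto
    next
      case yz: (split_right f g)
      have "V_dist x z \<le> (V_dist x f + V_dist x g) / 2" using le_right yz V by simp
      moreover have "V_dist x f \<le> V_dist x y + V_dist y f" "V_dist x g \<le> V_dist x y + V_dist y g"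
        using IH[of x y f] IH[of x y g] V yz by auto
      ultimately show ?thesis using yz(5) by (simp add: field_simps)
    next
      case yz: (split_left c' e')
      have "V_dist c z + V_dist e z = V_dist c' z + V_dist e' z"
        using xy(2) yz(2) by (auto simp: fdoubleton_eq_iff)
      moreover have "V_dist x z \<le> V_dist x c + V_dist c z" "V_dist x z \<le> V_dist x e + V_dist e z"
        using IH[of x c z] IH[of x e z] V xy by auto
      ultimately show ?thesis using xy(5) yz(5) by (simp add: field_simps)
    next
      case yz: (match c' e' f g)
      have "V_dist x c + V_dist x e = V_dist x c' + V_dist x e'"
        using xy(2) yz(2) by (auto simp: fdoubleton_eq_iff)
      moreover have "V_dist x z \<le> (V_dist x f + V_dist x g) / 2" using le_right yz V by simp
      moreover have "V_dist x f \<le> V_dist x c' + V_dist c' f"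
        "V_dist x g \<le> V_dist x e' + V_dist e' g"
        using IH[of x c' f] IH[of x e' g] V yz by auto
      ultimately show ?thesis using xy(5) yz(9) by (simp add: field_simps)
    qed
  next
    case xy: (match a b c e)
    from V(2,3) show ?thesis
    proof (cases rule: V_dist_cases)
      case (atom l n)
      then show ?thesis using xy by auto
    next
      case yz: (split_right f g)
      have "V_dist x z \<le> (V_dist x f + V_dist x g) / 2" using le_right yz V by simp
      moreover have "V_dist x f \<le> V_dist x y + V_dist y f" "V_dist x g \<le> V_dist x y + V_dist y g"
        using IH[of x y f] IH[of x y g] V yz by auto
      ultimately show ?thesis using yz(5) by (simp add: field_simps)
    next
      case yz: (split_left c' e')
      have "V_dist c z + V_dist e z = V_dist c' z + V_dist e' z"
        using xy(6) yz(2) by (auto simp: fdoubleton_eq_iff)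
      moreover have "V_dist x z \<le> (V_dist a z + V_dist b z) / 2" using le_left xy V by simp
      moreover have "V_dist a z \<le> V_dist a c + V_dist c z" "V_dist b z \<le> V_dist b e + V_dist e z"
        using IH[of a c z] IH[of b e z] V xy by auto
      ultimately show ?thesis using xy(9) yz(5) by (simp add: field_simps)
    next
      case yz: (match c' e' f' g')
      obtain f g where fg: "f \<noteq> g" "z = Hset {|f, g|}" "f \<in> V_space j" "g \<in> V_space j"
        "V_dist y z = (V_dist c f + V_dist e g) / 2"
      proof (cases "c' = c \<and> e' = e")
        case True
        then show thesis using yz that[of f' g'] by simp
      next
        case False
        then have "c' = e" "e' = c" using xy(6) yz(2) by (auto simp: fdoubleton_eq_iff)
        moreover have "z = Hset {|g', f'|}" using yz by (simp add: finsert_commute)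
        ultimately show thesis using yz that[of g' f'] by (simp add: add.commute)
      qed
      have "V_dist x z \<le> (V_dist a f + V_dist b g) / 2" using le_match xy(1,2) fg(1,2) by simp
      moreover have "V_dist a f \<le> V_dist a c + V_dist c f" "V_dist b g \<le> V_dist b e + V_dist e g"
        using IH[of a c f] IH[of b e g] V xy fg by auto
      ultimately show ?thesis using xy(9) fg(5) by (simp add: field_simps)
    qed
  qed
qed

lemma Metric_space_V: "Metric_space (V_space j) V_dist"
  by unfold_locales
    (use V_dist_nonneg V_dist_commute V_dist_self V_dist_zero V_dist_triangle in blast)+

definition V_metric :: "nat \<Rightarrow> elt metric" where
  "V_metric j = metric (V_space j, V_dist)"

lemma mspace_V_metric [simp]: "mspace (V_metric j) = V_space j"
  and mdist_V_metric [simp]: "mdist (V_metric j) = V_dist"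
  using Metric_space_V unfolding V_metric_def
  by (simp_all add: Metric_space.mspace_metric Metric_space.mdist_metric)

definition metric_completion_of :: "'a metric \<Rightarrow> 'b metric \<Rightarrow> ('a \<Rightarrow> 'b) \<Rightarrow> bool" where
  "metric_completion_of M X \<iota> \<longleftrightarrow>
     mcomplete_of X \<and>
     \<iota> \<in> mspace M \<rightarrow> mspace X \<and>
     (\<forall>x\<in>mspace M. \<forall>y\<in>mspace M. mdist X (\<iota> x) (\<iota> y) = mdist M x y) \<and>
     mtopology_of X closure_of (\<iota> ` mspace M) = mspace X"

lemma V_metric_completion_exists:
  "\<exists>(X :: (elt \<Rightarrow> real) metric) \<iota>. metric_completion_of (V_metric j) X \<iota>"
proof -
  interpret Metric_space "V_space j" V_dist by (rule Metric_space_V)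
  show ?thesis
    using metric_completion unfolding metric_completion_of_def by (metis mspace_V_metric mdist_V_metric)
qed

definition geodesic :: "'a metric \<Rightarrow> (real \<Rightarrow> 'a) \<Rightarrow> bool" where
  "geodesic X c \<longleftrightarrow>
     c \<in> {0..1} \<rightarrow> mspace X \<and>
     (\<forall>s\<in>{0..1}. \<forall>t\<in>{0..1}. mdist X (c s) (c t) = \<bar>s - t\<bar> * mdist X (c 0) (c 1))"

definition bicombing :: "'a metric \<Rightarrow> ('a \<Rightarrow> 'a \<Rightarrow> real \<Rightarrow> 'a) \<Rightarrow> bool" where
  "bicombing X \<sigma> \<longleftrightarrow>
     (\<forall>x\<in>mspace X. \<forall>y\<in>mspace X. geodesic X (\<sigma> x y) \<and> \<sigma> x y 0 = x \<and> \<sigma> x y 1 = y)"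

definition conical :: "'a metric \<Rightarrow> ('a \<Rightarrow> 'a \<Rightarrow> real \<Rightarrow> 'a) \<Rightarrow> bool" where
  "conical X \<sigma> \<longleftrightarrow>
     (\<forall>x\<in>mspace X. \<forall>y\<in>mspace X. \<forall>x'\<in>mspace X. \<forall>y'\<in>mspace X. \<forall>t\<in>{0..1}.
        mdist X (\<sigma> x y t) (\<sigma> x' y' t) \<le> (1 - t) * mdist X x x' + t * mdist X y y')"

definition sigma_convex :: "'a metric \<Rightarrow> ('a \<Rightarrow> 'a \<Rightarrow> real \<Rightarrow> 'a) \<Rightarrow> 'a set \<Rightarrow> bool" where
  "sigma_convex X \<sigma> C \<longleftrightarrow>
     C \<subseteq> mspace X \<and> (\<forall>x\<in>C. \<forall>y\<in>C. \<sigma> x y ` {0..1} \<subseteq> C)"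

definition sigma_conv :: "'a metric \<Rightarrow> ('a \<Rightarrow> 'a \<Rightarrow> real \<Rightarrow> 'a) \<Rightarrow> 'a set \<Rightarrow> 'a set" where
  "sigma_conv X \<sigma> A =
     \<Inter> {C. closedin (mtopology_of X) C \<and> sigma_convex X \<sigma> C \<and> A \<subseteq> C}"

end

theory Submission
  imports Defs
begin

text \<open>The map \<open>mpair\<close> is a conical midpoint map on \<open>V\<close>; iterated bisection with it gives a conical
  bicombing of the completion. A closed convex set containing the atoms contains all of \<open>V\<close>, hence
  everything.

  For non-compactness, view \<open>d(x, y)\<close> as the least probability that two coupled random walks, moving
  from points to uniformly chosen parents, end in different atoms. The distance from a fixed atom is
  a martingale along each walk. For two atoms, walks from \<open>x\<close> and \<open>y\<close> at distance \<open>1/2\<close> from that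
  atom disagree with probability \<open>1/2\<close> if they are independent, and coupling can only help by the
  number of steps of one walk times the typical step size of the other. There are \<open>y\<close> for which the
  latter is arbitrarily small, so the points at distance \<open>1/2\<close> from the atom are not totally
  bounded.\<close>

section \<open>Bicombings from conical midpoint maps\<close>

text \<open>By the triangle inequality the bounds \<open>m_left\<close> and \<open>m_right\<close>
  are equalities, so \<open>m a b\<close> is a metric midpoint; in particular
  \<open>m a a = a\<close>.\<close>

locale conical_midpoints = Metric_space +
  fixes m :: "'a \<Rightarrow> 'a \<Rightarrow> 'a"
  assumes m_closed: "\<lbrakk>a \<in> M; b \<in> M\<rbrakk> \<Longrightarrow> m a b \<in> M"
    and m_conical: "\<lbrakk>a \<in> M; b \<in> M; a' \<in> M; b' \<in> M\<rbrakk>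
      \<Longrightarrow> d (m a b) (m a' b') \<le> (d a a' + d b b') / 2"
    and m_left: "\<lbrakk>a \<in> M; b \<in> M\<rbrakk> \<Longrightarrow> d a (m a b) \<le> d a b / 2"
    and m_right: "\<lbrakk>a \<in> M; b \<in> M\<rbrakk> \<Longrightarrow> d (m a b) b \<le> d a b / 2"
begin

text \<open>A step function approximating the geodesic: for t in [0, 1] its value is the point that
  n-fold bisection assigns to the largest multiple of 1/2^n not exceeding t. This rounding is the
  source of all errors of order 1/2^n below.\<close>

primrec bisect :: "nat \<Rightarrow> 'a \<Rightarrow> 'a \<Rightarrow> real \<Rightarrow> 'a" where
  "bisect 0 a b t = (if t < 1 then a else b)"
| "bisect (Suc n) a b t =
     (if t \<le> 1/2 then bisect n a (m a b) (2 * t) else bisect n (m a b) b (2 * t - 1))"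

lemma bisect_closed: "\<lbrakk>a \<in> M; b \<in> M\<rbrakk> \<Longrightarrow> bisect n a b t \<in> M"
  by (induction n arbitrary: a b t) (auto simp: m_closed)

lemma bisect_0: "bisect n a b 0 = a"
  by (induction n arbitrary: b) auto

lemma bisect_1: "bisect n a b 1 = b"
  by (induction n arbitrary: a) auto

lemma bisect_half: "n > 0 \<Longrightarrow> bisect n a b (1/2) = m a b"
  by (cases n) (auto simp: bisect_1)

lemma bisect_same: "a \<in> M \<Longrightarrow> bisect n a a t = a"
proof (induction n arbitrary: t)
  case (Suc n)
  have "m a a = a"
    using m_left[of a a] m_closed[of a a] nonneg[of a "m a a"] zero[of a "m a a"] Suc.prems by simp
  then show ?case using Suc by simp
qed auto

text \<open>On either half of the interval, \<open>m_conical\<close> interpolates the bound at the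
  midpoint, so the conical inequality survives a bisection. The last summand pays for the rounding
  of t at level 0 and is halved by each bisection, since midpoints halve the distance of the
  endpoints.\<close>

lemma bisect_conical:
  assumes "a \<in> M" "b \<in> M" "a' \<in> M" "b' \<in> M" "t \<in> {0..1}"
  shows "d (bisect n a b t) (bisect n a' b' t)
    \<le> (1 - t) * d a a' + t * d b b' + (d a b + d a' b') / 2 ^ n"
  using assms
proof (induction n arbitrary: a b a' b' t)
  case 0
  show ?case
  proof (cases "t < 1")
    case True
    \<comment> \<open>At level 0 both values are the left endpoints, while the bound gives
      \<open>d a a'\<close> only the weight 1 - t; the detour through \<open>b\<close> and
      \<open>b'\<close> supplies the missing t.\<close>
    have "d a a' \<le> d a b + d b b' + d a' b'"
      using triangle[of a b a'] triangle[of b b' a'] commute[of a' b'] 0 by simp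
    then have "t * d a a' \<le> t * (d b b' + (d a b + d a' b'))"
      using 0 by (intro mult_left_mono) auto
    moreover have "t * (d a b + d a' b') \<le> d a b + d a' b'"
      using 0 True by (intro mult_left_le_one_le) auto
    ultimately show ?thesis using True by (simp add: algebra_simps)
  qed (use 0 in auto)
next
  case (Suc n)
  let ?p = "m a b" and ?q = "m a' b'"
  have p: "?p \<in> M" "?q \<in> M" using m_closed Suc.prems by auto
  have pq: "d ?p ?q \<le> (d a a' + d b b') / 2" using m_conical Suc.prems by simp
  show ?case
  proof (cases "t \<le> 1/2")
    case True
    have "d (bisect n a ?p (2 * t)) (bisect n a' ?q (2 * t))
        \<le> (1 - 2 * t) * d a a' + 2 * t * d ?p ?q + (d a ?p + d a' ?q) / 2 ^ n"
      using Suc.IH[of a ?p a' ?q "2 * t"] p Suc.prems True by simp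
    also have "\<dots> \<le> (1 - 2 * t) * d a a' + 2 * t * ((d a a' + d b b') / 2)
        + (d a b / 2 + d a' b' / 2) / 2 ^ n"
      using pq m_left Suc.prems True
      by (intro add_mono divide_right_mono mult_left_mono order_refl) simp_all
    also have "\<dots> = (1 - t) * d a a' + t * d b b' + (d a b + d a' b') / 2 ^ Suc n"
      by (simp add: field_simps)
    finally show ?thesis using True by simp
  next
    case False
    have "d (bisect n ?p b (2 * t - 1)) (bisect n ?q b' (2 * t - 1))
        \<le> (1 - (2 * t - 1)) * d ?p ?q + (2 * t - 1) * d b b' + (d ?p b + d ?q b') / 2 ^ n"
      using Suc.IH[of ?p b ?q b' "2 * t - 1"] p Suc.prems False by simp
    also have "\<dots> \<le> (1 - (2 * t - 1)) * ((d a a' + d b b') / 2) + (2 * t - 1) * d b b'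
        + (d a b / 2 + d a' b' / 2) / 2 ^ n"
      using pq m_right Suc.prems False
      by (intro add_mono divide_right_mono mult_left_mono order_refl) simp_all
    also have "\<dots> = (1 - t) * d a a' + t * d b b' + (d a b + d a' b') / 2 ^ Suc n"
      by (simp add: field_simps)
    finally show ?thesis using False by simp
  qed
qed

text \<open>This compares the path with the constant path at \<open>a\<close>;
  \<open>bisect_right\<close> does the same at \<open>b\<close>.\<close>

lemma bisect_left:
  assumes "a \<in> M" "b \<in> M" "t \<in> {0..1}"
  shows "d a (bisect n a b t) \<le> (t + 1 / 2 ^ n) * d a b"
  using bisect_conical[of a a a b t n] assms by (simp add: bisect_same algebra_simps)

lemma bisect_right:
  assumes "a \<in> M" "b \<in> M" "t \<in> {0..1}"
  shows "d (bisect n a b t) b \<le> (1 - t + 1 / 2 ^ n) * d a b"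
  using bisect_conical[of a b b b t n] assms by (simp add: bisect_same algebra_simps)

text \<open>If s and t lie in the same half, rescaling doubles t - s and halves the distance of the
  endpoints; otherwise the estimate goes through the midpoint. The slack 2/2^n accounts for the
  rounding of both parameters.\<close>

lemma bisect_lipschitz:
  assumes "a \<in> M" "b \<in> M" "0 \<le> s" "s \<le> t" "t \<le> 1"
  shows "d (bisect n a b s) (bisect n a b t) \<le> (t - s + 2 / 2 ^ n) * d a b"
  using assms
proof (induction n arbitrary: a b s t)
  case 0
  have "1 * d a b \<le> (t - s + 2) * d a b"
    using 0 by (intro mult_right_mono) auto
  moreover have "0 \<le> (t - s + 2) * d a b" using 0 by simp
  ultimately show ?case using 0 by (auto simp: commute)
next
  case (Suc n)
  let ?p = "m a b"
  have p: "?p \<in> M" using m_closed Suc.prems by auto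
  have half: "r * d a ?p \<le> r * (d a b / 2)" "r * d ?p b \<le> r * (d a b / 2)" if "0 \<le> r" for r
    by (rule mult_left_mono[OF m_left that] mult_left_mono[OF m_right that]; use Suc.prems in simp)+
  consider "t \<le> 1/2" | "s \<le> 1/2" "1/2 < t" | "1/2 < s" by linarith
  then show ?case
  proof cases
    case 1
    have "d (bisect n a ?p (2 * s)) (bisect n a ?p (2 * t)) \<le> (2 * t - 2 * s + 2 / 2 ^ n) * d a ?p"
      using Suc.IH[of a ?p "2 * s" "2 * t"] p Suc.prems 1 by simp
    also have "\<dots> \<le> (2 * t - 2 * s + 2 / 2 ^ n) * (d a b / 2)"
      using Suc.prems by (intro half) simp
    also have "\<dots> = (t - s + 2 / 2 ^ Suc n) * d a b"
      by (simp add: field_simps)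
    finally show ?thesis using 1 Suc.prems by simp
  next
    case 2
    have "d (bisect n a ?p (2 * s)) (bisect n ?p b (2 * t - 1))
        \<le> d (bisect n a ?p (2 * s)) ?p + d ?p (bisect n ?p b (2 * t - 1))"
      using p Suc.prems by (intro triangle bisect_closed) auto
    also have "\<dots> \<le> (1 - 2 * s + 1 / 2 ^ n) * d a ?p + (2 * t - 1 + 1 / 2 ^ n) * d ?p b"
      using bisect_right[of a ?p "2 * s" n] bisect_left[of ?p b "2 * t - 1" n] p Suc.prems 2
      by (intro add_mono) auto
    also have "\<dots> \<le> (1 - 2 * s + 1 / 2 ^ n) * (d a b / 2) + (2 * t - 1 + 1 / 2 ^ n) * (d a b / 2)"
      using Suc.prems 2 by (intro add_mono half) auto
    also have "\<dots> = (t - s + 2 / 2 ^ Suc n) * d a b"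
      by (simp add: field_simps)
    finally show ?thesis using 2 by simp
  next
    case 3
    have "d (bisect n ?p b (2 * s - 1)) (bisect n ?p b (2 * t - 1))
        \<le> (2 * t - 2 * s + 2 / 2 ^ n) * d ?p b"
      using Suc.IH[of ?p b "2 * s - 1" "2 * t - 1"] p Suc.prems 3 by simp
    also have "\<dots> \<le> (2 * t - 2 * s + 2 / 2 ^ n) * (d a b / 2)"
      using Suc.prems by (intro half) simp
    also have "\<dots> = (t - s + 2 / 2 ^ Suc n) * d a b"
      by (simp add: field_simps)
    finally show ?thesis using 3 Suc.prems by simp
  qed
qed

text \<open>At level 0 the coarse path sits at an endpoint, within \<open>2 * d a b\<close> of the
  fine path. Each bisection shared by both paths halves this bound.\<close>

lemma bisect_cauchy:
  assumes "a \<in> M" "b \<in> M" "t \<in> {0..1}" "n \<le> k"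
  shows "d (bisect n a b t) (bisect k a b t) \<le> 2 * d a b / 2 ^ n"
  using assms
proof (induction n arbitrary: k a b t)
  case 0
  have le: "(s + 1 / 2 ^ k) * d a b \<le> 2 * d a b" if "s \<le> 1" for s
  proof (rule mult_right_mono)
    have "(1::real) / 2 ^ k \<le> 1" by simp
    then show "s + 1 / 2 ^ k \<le> 2" using that by linarith
  qed simp
  have "d a (bisect k a b t) \<le> 2 * d a b" "d b (bisect k a b t) \<le> 2 * d a b"
    using order_trans[OF bisect_left[of a b t k] le] order_trans[OF bisect_right[of a b t k] le]
      commute[of b "bisect k a b t"] 0 by simp_all
  then show ?case by simp
next
  case (Suc n)
  then obtain l where k: "k = Suc l" "n \<le> l" by (cases k) auto
  let ?p = "m a b"
  have p: "?p \<in> M" using m_closed Suc.prems by auto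
  have half: "2 * d a ?p / 2 ^ n \<le> 2 * d a b / 2 ^ Suc n" "2 * d ?p b / 2 ^ n \<le> 2 * d a b / 2 ^ Suc n"
    using m_left[of a b] m_right[of a b] Suc.prems by (simp_all add: field_simps)
  show ?case
  proof (cases "t \<le> 1/2")
    case True
    then have "d (bisect n a ?p (2 * t)) (bisect l a ?p (2 * t)) \<le> 2 * d a ?p / 2 ^ n"
      using Suc.IH[of a ?p "2 * t" l] p Suc.prems k by simp
    then show ?thesis using True half(1) k(1) by simp
  next
    case False
    then have "d (bisect n ?p b (2 * t - 1)) (bisect l ?p b (2 * t - 1)) \<le> 2 * d ?p b / 2 ^ n"
      using Suc.IH[of ?p b "2 * t - 1" l] p Suc.prems k by simp
    then show ?thesis using False half(2) k(1) by simp
  qed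
qed

end

section \<open>Passage to the completion\<close>

lemma mdist_tendsto:
  assumes "p \<in> mspace X" "q \<in> mspace X" "\<And>n. P n \<in> mspace X" "\<And>n. Q n \<in> mspace X"
    and "(\<lambda>n. mdist X (P n) p) \<longlonglongrightarrow> 0" "(\<lambda>n. mdist X (Q n) q) \<longlonglongrightarrow> 0"
  shows "(\<lambda>n. mdist X (P n) (Q n)) \<longlonglongrightarrow> mdist X p q"
proof -
  interpret X: Metric_space "mspace X" "mdist X" by simp
  have "\<bar>mdist X (P n) (Q n) - mdist X p q\<bar> \<le> mdist X (P n) p + mdist X (Q n) q" for n
    using X.triangle[of "P n" p "Q n"] X.triangle[of p q "Q n"] X.triangle[of p "P n" q]
      X.triangle[of "P n" "Q n" q] X.commute[of p "P n"] X.commute[of q "Q n"]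
      assms(1,2) assms(3,4)[of n]
    unfolding abs_le_iff by linarith
  then have "\<forall>\<^sub>F n in sequentially.
      norm (mdist X (P n) (Q n) - mdist X p q) \<le> mdist X (P n) p + mdist X (Q n) q"
    unfolding real_norm_def by (intro always_eventually allI)
  moreover have "(\<lambda>n. mdist X (P n) p + mdist X (Q n) q) \<longlonglongrightarrow> 0"
    using tendsto_add[OF assms(5,6)] by simp
  ultimately have "(\<lambda>n. mdist X (P n) (Q n) - mdist X p q) \<longlonglongrightarrow> 0"
    by (rule Lim_null_comparison)
  then show ?thesis by (simp add: LIM_zero_iff)
qed

lemma metric_completion_dense:
  assumes "metric_completion_of M X \<iota>" "x \<in> mspace X" "r > 0"
  shows "\<exists>a\<in>mspace M. mdist X (\<iota> a) x < r"
proof -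
  interpret X: Metric_space "mspace X" "mdist X" by simp
  have "x \<in> X.mtopology closure_of (\<iota> ` mspace M)"
    using assms(1,2) by (simp add: metric_completion_of_def mtopology_of_def)
  then show ?thesis
    using assms(3) unfolding X.metric_closure_of by (fastforce simp: X.commute)
qed

text \<open>Both endpoints are approximated from the dense subset while the dyadic subdivision is
  refined, so the midpoint map itself need not be extended to the completion.\<close>

lemma (in conical_midpoints) completion_conical_bicombing:
  assumes compl: "metric_completion_of (metric (M, d)) X \<iota>"
  obtains \<sigma> where "bicombing X \<sigma>" "conical X \<sigma>"
    "\<And>a b. \<lbrakk>a \<in> M; b \<in> M\<rbrakk> \<Longrightarrow> \<sigma> (\<iota> a) (\<iota> b) (1/2) = \<iota> (m a b)"
proof -
  interpret X: Metric_space "mspace X" "mdist X" by simp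
  have complete: "X.mcomplete" and \<iota>: "\<And>a. a \<in> M \<Longrightarrow> \<iota> a \<in> mspace X"
    and iso: "\<And>a b. \<lbrakk>a \<in> M; b \<in> M\<rbrakk> \<Longrightarrow> mdist X (\<iota> a) (\<iota> b) = d a b"
    using compl by (auto simp: metric_completion_of_def mcomplete_of_def)
  have "\<exists>a\<in>M. mdist X (\<iota> a) x < (1/2) ^ n" if "x \<in> mspace X" for x n
    using metric_completion_dense[OF compl that, of "(1/2) ^ n"] by simp
  then have "\<exists>u. \<forall>n x. x \<in> mspace X \<longrightarrow> u n x \<in> M \<and> mdist X (\<iota> (u n x)) x < (1/2) ^ n"
    by (intro choice allI) blast
  then obtain u where u: "\<And>x n. x \<in> mspace X \<Longrightarrow> u n x \<in> M"
    and u_dist: "\<And>x n. x \<in> mspace X \<Longrightarrow> mdist X (\<iota> (u n x)) x < (1/2) ^ n"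
    by blast
  have u_lim: "(\<lambda>n. mdist X (\<iota> (u n x)) x) \<longlonglongrightarrow> 0" if "x \<in> mspace X" for x
  proof (rule Lim_null_comparison)
    show "\<forall>\<^sub>F n in sequentially. norm (mdist X (\<iota> (u n x)) x) \<le> (1/2) ^ n"
      using u_dist[OF that] by (intro always_eventually) (auto intro: less_imp_le)
  qed (simp add: LIMSEQ_power_zero)
  have u_mdist: "(\<lambda>n. d (u n x) (u n y)) \<longlonglongrightarrow> mdist X x y"
    if "x \<in> mspace X" "y \<in> mspace X" for x y
    using mdist_tendsto[OF that _ _ u_lim[OF that(1)] u_lim[OF that(2)]] that u \<iota>
    by (simp add: iso)
  define P where "P n x y t = \<iota> (bisect n (u n x) (u n y) t)" for n x y t
  have P: "P n x y t \<in> mspace X" if "x \<in> mspace X" "y \<in> mspace X" for n x y t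
    using that unfolding P_def by (intro \<iota> bisect_closed u)
  have u_near: "d (u n x) (u k x) \<le> 2 * (1/2) ^ n" if "x \<in> mspace X" "n \<le> k" for n k x
  proof -
    have "(1/2::real) ^ k \<le> (1/2) ^ n" using that(2) by (intro power_decreasing) auto
    then have "mdist X (\<iota> (u n x)) (\<iota> (u k x)) \<le> 2 * (1/2) ^ n"
      using X.triangle[of "\<iota> (u n x)" x "\<iota> (u k x)"] X.commute[of x "\<iota> (u k x)"]
        u_dist[OF that(1), of n] u_dist[OF that(1), of k]
        \<iota>[OF u[OF that(1), of n]] \<iota>[OF u[OF that(1), of k]] that(1) by linarith
    then show ?thesis by (simp add: iso u that(1))
  qed
  \<comment> \<open>Two moves: refine the subdivision from level n to k with the endpoints of stage
    n, then exchange the endpoints at level k. With D the distance of x and y and e = (1/2)^n, the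
    first costs 2 (D + 2) e and the second 2 e + 2 (D + 2) e.\<close>
  have P_near: "mdist X (P n x y t) (P k x y t) \<le> (4 * mdist X x y + 10) * (1/2) ^ n"
    if xy: "x \<in> mspace X" "y \<in> mspace X" and t: "t \<in> {0..1}" and "n \<le> k" for n k x y t
  proof -
    let ?D = "mdist X x y"
    have uD: "d (u i x) (u i y) \<le> ?D + 2" for i
    proof -
      have "(1/2::real) ^ i \<le> 1" by (intro power_le_one) auto
      then have "mdist X (\<iota> (u i x)) (\<iota> (u i y)) \<le> ?D + 2"
        using X.triangle[of "\<iota> (u i x)" x "\<iota> (u i y)"] X.triangle[of x y "\<iota> (u i y)"]
          X.commute[of y "\<iota> (u i y)"] u_dist[OF xy(1), of i] u_dist[OF xy(2), of i]
          \<iota>[OF u[OF xy(1), of i]] \<iota>[OF u[OF xy(2), of i]] xy by linarith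
      then show ?thesis by (simp add: iso u xy)
    qed
    define e :: real where "e = (1/2) ^ n"
    have e: "0 \<le> e" "(1/2) ^ k \<le> e" unfolding e_def
      using \<open>n \<le> k\<close> by (auto intro: power_decreasing)
    have "d (bisect n (u n x) (u n y) t) (bisect k (u k x) (u k y) t)
        \<le> d (bisect n (u n x) (u n y) t) (bisect k (u n x) (u n y) t)
          + d (bisect k (u n x) (u n y) t) (bisect k (u k x) (u k y) t)"
      by (intro triangle bisect_closed u xy)
    also have "d (bisect n (u n x) (u n y) t) (bisect k (u n x) (u n y) t) \<le> 2 * d (u n x) (u n y) * e"
      using bisect_cauchy[OF u[OF xy(1)] u[OF xy(2)] t \<open>n \<le> k\<close>, of n n]
      by (simp add: e_def power_one_over)
    also have "\<dots> \<le> 2 * (?D + 2) * e"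
      using uD e by (intro mult_right_mono mult_left_mono) auto
    also have "d (bisect k (u n x) (u n y) t) (bisect k (u k x) (u k y) t)
        \<le> (1 - t) * d (u n x) (u k x) + t * d (u n y) (u k y)
          + (d (u n x) (u n y) + d (u k x) (u k y)) * (1/2) ^ k"
      using bisect_conical[of "u n x" "u n y" "u k x" "u k y" t k] u xy t
      by (simp add: power_one_over)
    also have "(1 - t) * d (u n x) (u k x) \<le> (1 - t) * (2 * e)"
      using t u_near[OF xy(1) \<open>n \<le> k\<close>] by (intro mult_left_mono) (simp_all add: e_def)
    also have "t * d (u n y) (u k y) \<le> t * (2 * e)"
      using t u_near[OF xy(2) \<open>n \<le> k\<close>] by (intro mult_left_mono) (simp_all add: e_def)
    also have "(d (u n x) (u n y) + d (u k x) (u k y)) * (1/2) ^ k \<le> (?D + 2 + (?D + 2)) * e"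
      by (rule mult_mono[OF add_mono[OF uD uD] e(2)]) simp_all
    also have "2 * (?D + 2) * e + ((1 - t) * (2 * e) + t * (2 * e) + (?D + 2 + (?D + 2)) * e)
        = (4 * ?D + 10) * e"
      by (simp add: algebra_simps)
    finally have "d (bisect n (u n x) (u n y) t) (bisect k (u k x) (u k y) t) \<le> (4 * ?D + 10) * e"
      by simp
    then show ?thesis
      unfolding P_def e_def using xy by (simp only: iso bisect_closed u)
  qed
  have "\<exists>p. limitin X.mtopology (\<lambda>n. P n x y t) p sequentially"
    if xy: "x \<in> mspace X" "y \<in> mspace X" and t: "t \<in> {0..1}" for x y t
  proof -
    have "X.MCauchy (\<lambda>n. P n x y t)"
      unfolding X.MCauchy_def
    proof (intro conjI allI impI)
      show "range (\<lambda>n. P n x y t) \<subseteq> mspace X" using P xy by auto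
      fix \<epsilon> :: real assume "\<epsilon> > 0"
      have "(\<lambda>n. (4 * mdist X x y + 10) * (1/2) ^ n) \<longlonglongrightarrow> (4 * mdist X x y + 10) * 0"
        by (intro tendsto_intros LIMSEQ_power_zero) auto
      then have "\<forall>\<^sub>F n in sequentially. (4 * mdist X x y + 10) * (1/2) ^ n < \<epsilon>"
        using \<open>\<epsilon> > 0\<close> by (intro order_tendstoD) auto
      then obtain N where N: "\<And>n. n \<ge> N \<Longrightarrow> (4 * mdist X x y + 10) * (1/2) ^ n < \<epsilon>"
        by (auto simp: eventually_sequentially)
      have "mdist X (P n x y t) (P k x y t) < \<epsilon>" if "N \<le> n" "n \<le> k" for n k
        using P_near[OF xy t that(2)] N[OF that(1)] by linarith
      then show "\<exists>N. \<forall>n n'. N \<le> n \<longrightarrow> N \<le> n' \<longrightarrow> mdist X (P n x y t) (P n' x y t) < \<epsilon>"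
        by (metis X.commute nat_le_linear)
    qed
    then show ?thesis using complete by (simp add: X.mcomplete_def)
  qed
  then have "\<exists>p. p \<in> mspace X \<and> (\<lambda>n. mdist X (P n x y t) p) \<longlonglongrightarrow> 0"
    if "x \<in> mspace X" "y \<in> mspace X" "t \<in> {0..1}" for x y t
    using that by (fastforce simp: X.limitin_metric_dist_null)
  then obtain \<sigma> where \<sigma>:
      "\<And>x y t. \<lbrakk>x \<in> mspace X; y \<in> mspace X; t \<in> {0..1}\<rbrakk> \<Longrightarrow> \<sigma> x y t \<in> mspace X"
    and \<sigma>_lim: "\<And>x y t. \<lbrakk>x \<in> mspace X; y \<in> mspace X; t \<in> {0..1}\<rbrakk>
      \<Longrightarrow> (\<lambda>n. mdist X (P n x y t) (\<sigma> x y t)) \<longlonglongrightarrow> 0"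
    by metis
  have P_lim: "(\<lambda>n. mdist X (P n x y s) (P n x' y' t)) \<longlonglongrightarrow> mdist X (\<sigma> x y s) (\<sigma> x' y' t)"
    if "x \<in> mspace X" "y \<in> mspace X" "s \<in> {0..1}" "x' \<in> mspace X" "y' \<in> mspace X" "t \<in> {0..1}"
    for x y s x' y' t
    using that by (intro mdist_tendsto \<sigma> \<sigma>_lim P)
  \<comment> \<open>Uniqueness of limits, used to identify \<open>\<sigma>\<close> at the times 0, 1
    and 1/2.\<close>
  have \<sigma>_eq: "\<sigma> x y t = z"
    if "x \<in> mspace X" "y \<in> mspace X" "t \<in> {0..1}" "z \<in> mspace X"
      "(\<lambda>n. mdist X (P n x y t) z) \<longlonglongrightarrow> 0" for x y t z
  proof -
    have "(\<lambda>n. mdist X (P n x y t) (P n x y t)) \<longlonglongrightarrow> mdist X (\<sigma> x y t) z"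
      using that by (intro mdist_tendsto \<sigma> \<sigma>_lim P)
    then have "mdist X (\<sigma> x y t) z = 0"
      using that P by (simp add: LIMSEQ_const_iff)
    then show ?thesis using \<sigma> that by simp
  qed
  have \<sigma>_0: "\<sigma> x y 0 = x" and \<sigma>_1: "\<sigma> x y 1 = y" if "x \<in> mspace X" "y \<in> mspace X" for x y
    using that u_lim by (auto intro!: \<sigma>_eq simp: P_def bisect_0 bisect_1)
  \<comment> \<open>The rounding error of \<open>bisect_conical\<close> carries the factor (1/2)^n
    and vanishes in the limit; the same happens to the slack of \<open>bisect_lipschitz\<close>
    below.\<close>
  have conical: "mdist X (\<sigma> x y t) (\<sigma> x' y' t) \<le> (1 - t) * mdist X x x' + t * mdist X y y'"
    if "x \<in> mspace X" "y \<in> mspace X" "x' \<in> mspace X" "y' \<in> mspace X" "t \<in> {0..1}"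
    for x y x' y' t
  proof (rule LIMSEQ_le)
    show "(\<lambda>n. mdist X (P n x y t) (P n x' y' t)) \<longlonglongrightarrow> mdist X (\<sigma> x y t) (\<sigma> x' y' t)"
      using that by (intro P_lim)
    have "(\<lambda>n. (1 - t) * d (u n x) (u n x') + t * d (u n y) (u n y')
        + (d (u n x) (u n y) + d (u n x') (u n y')) * (1/2) ^ n)
      \<longlonglongrightarrow> (1 - t) * mdist X x x' + t * mdist X y y' + (mdist X x y + mdist X x' y') * 0"
      using that by (intro tendsto_intros u_mdist LIMSEQ_power_zero) auto
    then show "(\<lambda>n. (1 - t) * d (u n x) (u n x') + t * d (u n y) (u n y')
        + (d (u n x) (u n y) + d (u n x') (u n y')) * (1/2) ^ n)
      \<longlonglongrightarrow> (1 - t) * mdist X x x' + t * mdist X y y'" by simp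
    have "mdist X (P n x y t) (P n x' y' t) \<le> (1 - t) * d (u n x) (u n x') + t * d (u n y) (u n y')
        + (d (u n x) (u n y) + d (u n x') (u n y')) * (1/2) ^ n" for n
      using bisect_conical[OF u u u u, of x y x' y' t n n n n n] that
      by (simp add: P_def iso bisect_closed u power_one_over)
    then show "\<exists>N. \<forall>n\<ge>N. mdist X (P n x y t) (P n x' y' t)
      \<le> (1 - t) * d (u n x) (u n x') + t * d (u n y) (u n y')
        + (d (u n x) (u n y) + d (u n x') (u n y')) * (1/2) ^ n" by blast
  qed
  have lipschitz: "mdist X (\<sigma> x y s) (\<sigma> x y t) \<le> (t - s) * mdist X x y"
    if "x \<in> mspace X" "y \<in> mspace X" "0 \<le> s" "s \<le> t" "t \<le> 1" for x y s t
  proof (rule LIMSEQ_le)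
    show "(\<lambda>n. mdist X (P n x y s) (P n x y t)) \<longlonglongrightarrow> mdist X (\<sigma> x y s) (\<sigma> x y t)"
      using that by (intro P_lim) auto
    have "(\<lambda>n. (t - s + 2 * (1/2) ^ n) * d (u n x) (u n y)) \<longlonglongrightarrow> (t - s + 2 * 0) * mdist X x y"
      using that by (intro tendsto_intros u_mdist LIMSEQ_power_zero) auto
    then show "(\<lambda>n. (t - s + 2 * (1/2) ^ n) * d (u n x) (u n y)) \<longlonglongrightarrow> (t - s) * mdist X x y"
      by simp
    have "mdist X (P n x y s) (P n x y t) \<le> (t - s + 2 * (1/2) ^ n) * d (u n x) (u n y)" for n
      using bisect_lipschitz[OF u u, of x y s t n n n] that
      by (simp add: P_def iso bisect_closed u power_one_over)
    then show "\<exists>N. \<forall>n\<ge>N. mdist X (P n x y s) (P n x y t)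
      \<le> (t - s + 2 * (1/2) ^ n) * d (u n x) (u n y)" by blast
  qed
  have geodesic_le: "mdist X (\<sigma> x y s) (\<sigma> x y t) = (t - s) * mdist X x y"
    if xy: "x \<in> mspace X" "y \<in> mspace X" and "0 \<le> s" "s \<le> t" "t \<le> 1" for x y s t
  proof (rule antisym)
    \<comment> \<open>The Lipschitz bounds on [0, s], [s, t] and [t, 1] add up to exactly the
      distance of x and y, so the middle one cannot be strict.\<close>
    have "mdist X x y \<le> mdist X x (\<sigma> x y s) + mdist X (\<sigma> x y s) (\<sigma> x y t) + mdist X (\<sigma> x y t) y"
      using X.triangle[of x "\<sigma> x y s" y] X.triangle[of "\<sigma> x y s" "\<sigma> x y t" y] \<sigma> that by simp
    also have "mdist X x (\<sigma> x y s) \<le> s * mdist X x y"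
      using lipschitz[of x y 0 s] \<sigma>_0[OF xy] that by simp
    also have "mdist X (\<sigma> x y t) y \<le> (1 - t) * mdist X x y"
      using lipschitz[of x y t 1] \<sigma>_1[OF xy] that by simp
    finally show "(t - s) * mdist X x y \<le> mdist X (\<sigma> x y s) (\<sigma> x y t)"
      by (simp add: algebra_simps)
  qed (use lipschitz that in simp)
  have "mdist X (\<sigma> x y s) (\<sigma> x y t) = \<bar>s - t\<bar> * mdist X x y"
    if "x \<in> mspace X" "y \<in> mspace X" "s \<in> {0..1}" "t \<in> {0..1}" for x y s t
  proof (cases "s \<le> t")
    case True
    then show ?thesis using geodesic_le[of x y s t] that by simp
  next
    case False
    then show ?thesis
      using geodesic_le[of x y t s] that X.commute[of "\<sigma> x y s" "\<sigma> x y t"] by simp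
  qed
  then have "bicombing X \<sigma>"
    unfolding bicombing_def geodesic_def using \<sigma> \<sigma>_0 \<sigma>_1 by simp
  moreover have "conical X \<sigma>"
    unfolding conical_def using conical by blast
  moreover have "\<sigma> (\<iota> a) (\<iota> b) (1/2) = \<iota> (m a b)" if "a \<in> M" "b \<in> M" for a b
  proof (rule \<sigma>_eq)
    show "(\<lambda>n. mdist X (P n (\<iota> a) (\<iota> b) (1/2)) (\<iota> (m a b))) \<longlonglongrightarrow> 0"
    proof (rule Lim_null_comparison)
      \<comment> \<open>From level 1 on, 1/2 is a grid point and the approximation is the midpoint
        of the approximated endpoints. At level 0 the time 1/2 is rounded down to the left
        endpoint.\<close>
      have "norm (mdist X (P n (\<iota> a) (\<iota> b) (1/2)) (\<iota> (m a b))) \<le> (1/2) ^ n" if "n > 0" for n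
      proof -
        have "d (m (u n (\<iota> a)) (u n (\<iota> b))) (m a b)
            \<le> (mdist X (\<iota> (u n (\<iota> a))) (\<iota> a) + mdist X (\<iota> (u n (\<iota> b))) (\<iota> b)) / 2"
          using m_conical \<open>a \<in> M\<close> \<open>b \<in> M\<close> by (simp add: iso u \<iota>)
        also have "\<dots> \<le> (1/2) ^ n"
          using u_dist[OF \<iota>[OF \<open>a \<in> M\<close>], of n] u_dist[OF \<iota>[OF \<open>b \<in> M\<close>], of n] by simp
        finally show ?thesis
          using \<open>a \<in> M\<close> \<open>b \<in> M\<close> by (simp add: P_def bisect_half[OF that] iso u \<iota> m_closed)
      qed
      then show "\<forall>\<^sub>F n in sequentially.
          norm (mdist X (P n (\<iota> a) (\<iota> b) (1/2)) (\<iota> (m a b))) \<le> (1/2) ^ n"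
        by (rule eventually_mono[OF eventually_gt_at_top[of 0]])
    qed (simp add: LIMSEQ_power_zero)
  qed (use that \<iota> m_closed in auto)
  ultimately show thesis using that by blast
qed

section \<open>The midpoint map on \<open>V\<close>\<close>

lemma V_stage_Suc: "V_stage j n \<subseteq> V_stage j (Suc n)"
  by (force simp: mpair_def)

lemma mpair_in_V_space:
  assumes "a \<in> V_space j" "b \<in> V_space j"
  shows "mpair a b \<in> V_space j"
proof -
  obtain k l where "a \<in> V_stage j k" "b \<in> V_stage j l"
    using assms by (auto simp: V_space_def)
  then have "a \<in> V_stage j (max k l)" "b \<in> V_stage j (max k l)"
    using lift_Suc_mono_le[of "V_stage j", OF V_stage_Suc] by (auto intro: max.cobounded1 max.cobounded2)
  then have "mpair a b \<in> V_stage j (Suc (max k l))" by auto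
  then show ?thesis unfolding V_space_def by blast
qed

lemma Hset_in_V_space: "\<lbrakk>a \<in> V_space j; b \<in> V_space j; a \<noteq> b\<rbrakk> \<Longrightarrow> Hset {|a, b|} \<in> V_space j"
  using mpair_in_V_space[of a j b] by (simp add: mpair_def)

lemma Atom_in_V_space: "i < j \<Longrightarrow> Atom i \<in> V_space j"
proof -
  assume "i < j"
  then have "Atom i \<in> V_stage j 0" by simp
  then show ?thesis unfolding V_space_def by blast
qed

text \<open>Since \<open>V_dist\<close> does not depend on the number of atoms, this embeds
  \<open>V_space 2\<close> isometrically into \<open>V_space j\<close> for j > 1, and
  non-compactness can be tested there.\<close>

lemma V_space_mono:
  assumes "i \<le> j"
  shows "V_space i \<subseteq> V_space j"
proof -
  have "V_stage i n \<subseteq> V_stage j n" for n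
  proof (induction n)
    case 0
    then show ?case using assms by auto
  next
    case (Suc n)
    then show ?case by (simp only: V_stage.simps) blast
  qed
  then show ?thesis unfolding V_space_def by blast
qed

lemma V_dist_mpair_le:
  assumes "x \<in> V_space j" "a \<in> V_space j" "b \<in> V_space j"
  shows "V_dist x (mpair a b) \<le> (V_dist x a + V_dist x b) / 2"
  using V_dist_le_split[OF assms(1)] by (simp add: mpair_def)

text \<open>For two genuine pairs the bound is the matching term of the minimum defining the
  distance. A degenerate pair is a single point, and splitting the other pair gives the same
  bound.\<close>

lemma V_dist_mpair_mpair_le:
  assumes "a \<in> V_space j" "b \<in> V_space j" "c \<in> V_space j" "e \<in> V_space j"
  shows "V_dist (mpair a b) (mpair c e) \<le> (V_dist a c + V_dist b e) / 2"
proof (cases "a = b \<or> c = e")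
  case True
  then show ?thesis
  proof
    assume "a = b"
    then show ?thesis using V_dist_mpair_le[of a j c e] assms by (simp add: mpair_def)
  next
    assume "c = e"
    then show ?thesis
      using V_dist_mpair_le[of c j a b] assms V_dist_commute[of c] by (simp add: mpair_def)
  qed
next
  case False
  then show ?thesis using V_dist_le_match[of a b c e] by (simp add: mpair_def)
qed

lemma conical_midpoints_V: "conical_midpoints (V_space j) V_dist mpair"
proof -
  interpret Metric_space "V_space j" V_dist by (rule Metric_space_V)
  show ?thesis
  proof
    fix a b assume ab: "a \<in> V_space j" "b \<in> V_space j"
    show "V_dist a (mpair a b) \<le> V_dist a b / 2"
      using V_dist_mpair_le[of a j a b] ab by (simp add: V_dist_self)
    show "V_dist (mpair a b) b \<le> V_dist a b / 2"
      using V_dist_mpair_le[of b j a b] ab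
      by (simp add: V_dist_self V_dist_commute[of b])
  qed (use mpair_in_V_space V_dist_mpair_mpair_le in auto)
qed

section \<open>Failure of total boundedness\<close>

text \<open>\<open>V_dist (Atom 0)\<close> averages over parents, hence is a martingale along the random walk on
  \<open>V_space 2\<close> that moves from a point to a uniformly chosen parent. \<open>volatility_le y w\<close> says that
  the Snell envelope of the step sizes of this martingale, started at \<open>y\<close>, is at most \<open>w\<close>.\<close>

inductive volatility_le :: "elt \<Rightarrow> real \<Rightarrow> bool" where
  atom: "0 \<le> w \<Longrightarrow> volatility_le (Atom i) w"
| pair: "\<lbrakk>a \<noteq> b; volatility_le a u; volatility_le b v;
      \<bar>V_dist (Atom 0) a - V_dist (Atom 0) b\<bar> / 2 \<le> w; (u + v) / 2 \<le> w\<rbrakk>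
    \<Longrightarrow> volatility_le (Hset {|a, b|}) w"

lemma volatility_le_nonneg: "volatility_le y w \<Longrightarrow> 0 \<le> w"
  by (induction rule: volatility_le.induct) auto

lemma volatility_le_pairE:
  assumes "volatility_le (Hset {|c, e|}) w" "c \<noteq> e"
  obtains u v where "volatility_le c u" "volatility_le e v"
    "\<bar>V_dist (Atom 0) c - V_dist (Atom 0) e\<bar> / 2 \<le> w" "(u + v) / 2 \<le> w"
  using assms(1)
proof cases
  case (pair a b u v)
  then consider "a = c" "b = e" | "a = e" "b = c" by (auto simp: fdoubleton_eq_iff)
  then show thesis
  proof cases
    case 1
    then show thesis using pair that[of u v] by simp
  next
    case 2
    then show thesis using pair that[of v u] by (simp add: add.commute abs_minus_commute)
  qed
qed

lemma V_dist_Atom_le_1: "x \<in> V_space j \<Longrightarrow> V_dist (Atom i) x \<le> 1"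
proof (induction "size x" arbitrary: x rule: less_induct)
  case less
  from less.prems show ?case
  proof (cases rule: V_space_cases)
    case (pair a b)
    then have "V_dist (Atom i) a \<le> 1" "V_dist (Atom i) b \<le> 1"
      using less.hyps size_pair[OF pair(1)] by auto
    then show ?thesis using pair by simp
  qed simp
qed

text \<open>For a coupling of the walks from \<open>x\<close> and \<open>y\<close>, the first three terms are the probability that
  independent walks end in different atoms; a simultaneous step improves on this by the
  covariance of the two steps, and there are at most \<open>size x\<close> such steps.\<close>

lemma V_dist_ge_independent:
  assumes "x \<in> V_space 2" "y \<in> V_space 2" "volatility_le y w"
  shows "V_dist (Atom 0) x + V_dist (Atom 0) y - 2 * V_dist (Atom 0) x * V_dist (Atom 0) y
    - real (size x) * w \<le> V_dist x y"
  using assms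
proof (induction "size x + size y" arbitrary: x y w rule: less_induct)
  case less
  define p where "p = V_dist (Atom 0)"
  have IH: "p a + p b - 2 * p a * p b - real (size a) * u \<le> V_dist a b"
    if "size a + size b < size x + size y" "a \<in> V_space 2" "b \<in> V_space 2" "volatility_le b u"
    for a b u
    using less.hyps[OF that] unfolding p_def .
  have w: "0 \<le> w" using volatility_le_nonneg less.prems(3) .
  have "p x + p y - 2 * p x * p y - real (size x) * w \<le> V_dist x y"
    using less.prems(1,2)
  proof (cases rule: V_dist_cases)
    case (atom i k)
    \<comment> \<open>With two atoms \<open>p\<close> is 0 or 1 at each of them, and p + q - 2 p q
      is then the indicator of p \<noteq> q.\<close>
    have "i < 2" "k < 2"
      using less.prems(1,2) atom by (auto elim: V_space_cases)
    then have "i \<in> {0, 1}" "k \<in> {0, 1}" by auto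
    then have "p x + p y - 2 * p x * p y = V_dist x y"
      using atom by (auto simp: p_def)
    then show ?thesis using w by simp
  next
    case (split_right c e)
    obtain u v where uv: "volatility_le c u" "volatility_le e v" "(u + v) / 2 \<le> w"
      using volatility_le_pairE less.prems(3) split_right by metis
    \<comment> \<open>Only the walk from \<open>y\<close> moves: the formula is affine in
      \<open>p y\<close>, the factor \<open>size x\<close> stays, and the bounds \<open>u\<close>,
      \<open>v\<close> average to at most \<open>w\<close>.\<close>
    have "p x + p c - 2 * p x * p c - real (size x) * u \<le> V_dist x c"
      "p x + p e - 2 * p x * p e - real (size x) * v \<le> V_dist x e"
      using IH[OF _ less.prems(1)] split_right uv size_pair[OF split_right(1)] by auto
    moreover have "p y = (p c + p e) / 2" using split_right by (simp add: p_def)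
    moreover have "real (size x) * ((u + v) / 2) \<le> real (size x) * w"
      using uv by (intro mult_left_mono) auto
    ultimately show ?thesis using split_right(5) by (simp add: algebra_simps)
  next
    case (split_left a b)
    have "p a + p y - 2 * p a * p y - real (size a) * w \<le> V_dist a y"
      "p b + p y - 2 * p b * p y - real (size b) * w \<le> V_dist b y"
      using IH[OF _ _ less.prems(2,3)] split_left size_pair[OF split_left(1)] by auto
    moreover have "p x = (p a + p b) / 2" using split_left by (simp add: p_def)
    moreover have "(real (size a) * w + real (size b) * w) / 2 \<le> real (size x) * w"
    proof -
      have "0 \<le> real (size a) * w" "0 \<le> real (size b) * w" using w by auto
      moreover have "real (size x) * w = 3 * w + real (size a) * w + real (size b) * w"
        using split_left size_pair[OF split_left(1)] by (simp add: algebra_simps)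
      ultimately show ?thesis using w by argo
    qed
    ultimately show ?thesis using split_left(5) by (simp add: algebra_simps add_divide_distrib)
  next
    case (match a b c e)
    obtain u v where uv: "volatility_le c u" "volatility_le e v" "(u + v) / 2 \<le> w"
      and step: "\<bar>p c - p e\<bar> / 2 \<le> w"
      using volatility_le_pairE less.prems(3) match(5,6) unfolding p_def by metis
    have "p a + p c - 2 * p a * p c - real (size a) * u \<le> V_dist a c"
      "p b + p e - 2 * p b * p e - real (size b) * v \<le> V_dist b e"
      using IH match uv size_pair[OF match(1)] size_pair[OF match(5)] by auto
    moreover have px: "p x = (p a + p b) / 2" and py: "p y = (p c + p e) / 2"
      using match by (simp_all add: p_def)
    \<comment> \<open>The covariance of a simultaneous step: one factor is at most 1, the other is
      controlled by the volatility of \<open>y\<close>.\<close>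
    moreover have "(p a - p b) * (p c - p e) / 2 \<le> w"
    proof -
      have "\<bar>p a - p b\<bar> \<le> 1"
        using V_dist_Atom_le_1[OF match(3), of 0] V_dist_Atom_le_1[OF match(4), of 0]
          V_dist_nonneg[of "Atom 0" a] V_dist_nonneg[of "Atom 0" b] unfolding p_def by linarith
      then have "\<bar>p a - p b\<bar> * \<bar>p c - p e\<bar> \<le> 1 * \<bar>p c - p e\<bar>" by (intro mult_right_mono) auto
      moreover have "(p a - p b) * (p c - p e) \<le> \<bar>p a - p b\<bar> * \<bar>p c - p e\<bar>"
        by (metis abs_ge_self abs_mult)
      ultimately show ?thesis using step by linarith
    qed
    \<comment> \<open>Adding the nonnegative cross terms turns the left side into a multiple of (u +
      v) / 2. The pair itself adds 3 to \<open>size x\<close>, which leaves room to reserve one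
      \<open>w\<close> for the covariance.\<close>
    moreover have "(real (size a) * u + real (size b) * v) / 2 \<le> real (size x) * w - w"
    proof -
      have uv0: "0 \<le> u" "0 \<le> v" using uv volatility_le_nonneg by auto
      then have "0 \<le> real (size a) * v" "0 \<le> real (size b) * u" by auto
      moreover have "(real (size a) + real (size b)) * ((u + v) / 2) \<le> (real (size a) + real (size b)) * w"
        using uv by (intro mult_left_mono) auto
      moreover have "real (size x) * w = 3 * w + (real (size a) + real (size b)) * w"
        using match size_pair[OF match(1)] by (simp add: algebra_simps)
      ultimately show ?thesis using w by (simp add: algebra_simps)
    qed
    \<comment> \<open>Averaging the products along the matched parents gives the product of the
      averages plus the covariance term.\<close>
    moreover have "2 * p a * p c + 2 * p b * p e = 2 * (2 * p x * p y) + (p a - p b) * (p c - p e)"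
      unfolding px py by (simp add: field_simps)
    ultimately show ?thesis unfolding match(9) by argo
  qed
  then show ?case unfolding p_def .
qed

section \<open>Points of small volatility at dyadic distances\<close>

definition volatility_bounds :: "real \<Rightarrow> real set" where
  "volatility_bounds q = {w. \<exists>y\<in>V_space 2. V_dist (Atom 0) y = q \<and> volatility_le y w}"

lemma zero_in_volatility_bounds:
  assumes "i < 2"
  shows "0 \<in> volatility_bounds (real i)"
proof -
  have "V_dist (Atom 0) (Atom i) = real i" using assms by auto
  then show ?thesis
    using Atom_in_V_space[OF assms] volatility_le.atom[of 0 i]
    unfolding volatility_bounds_def by blast
qed

text \<open>As p \<noteq> r, the two witnesses are distinct and form a genuine pair; the first step
  of its martingale has size |p - r| / 2, after which either witness takes over with probability
  1/2.\<close>

lemma volatility_bounds_midpoint: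
  assumes "u \<in> volatility_bounds p" "v \<in> volatility_bounds r" "p \<noteq> r"
  shows "max (\<bar>p - r\<bar> / 2) ((u + v) / 2) \<in> volatility_bounds ((p + r) / 2)"
proof -
  obtain a b where a: "a \<in> V_space 2" "V_dist (Atom 0) a = p" "volatility_le a u"
    and b: "b \<in> V_space 2" "V_dist (Atom 0) b = r" "volatility_le b v"
    using assms(1,2) by (auto simp: volatility_bounds_def)
  have "a \<noteq> b" using a b assms(3) by auto
  then show ?thesis
    using a b volatility_le.pair[OF \<open>a \<noteq> b\<close> a(3) b(3), of "max (\<bar>p - r\<bar> / 2) ((u + v) / 2)"]
      Hset_in_V_space[OF a(1) b(1) \<open>a \<noteq> b\<close>]
    unfolding volatility_bounds_def by (auto intro!: bexI[of _ "Hset {|a, b|}"])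
qed

text \<open>Makes the infima below meaningful. A fraction with odd numerator is the midpoint of two
  adjacent fractions of the coarser grid.\<close>

lemma volatility_bounds_dyadic_nonempty:
  "k \<le> 2 ^ n \<Longrightarrow> volatility_bounds (real k / 2 ^ n) \<noteq> {}"
proof (induction n arbitrary: k)
  case 0
  then show ?case using zero_in_volatility_bounds[of k] by auto
next
  case (Suc n)
  show ?case
  proof (cases "even k")
    case True
    then obtain l where "k = 2 * l" by blast
    then show ?thesis using Suc.IH[of l] Suc.prems by simp
  next
    case False
    then obtain l where l: "k = 2 * l + 1" using oddE by blast
    have "l + 1 \<le> 2 ^ n" using l Suc.prems by simp
    then obtain u v where "u \<in> volatility_bounds (real l / 2 ^ n)"
      "v \<in> volatility_bounds (real (l + 1) / 2 ^ n)"
      using Suc.IH[of l] Suc.IH[of "l + 1"] by fastforce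
    moreover have "real l / 2 ^ n \<noteq> real (l + 1) / 2 ^ n" by (simp add: divide_cancel_right)
    ultimately have "volatility_bounds ((real l / 2 ^ n + real (l + 1) / 2 ^ n) / 2) \<noteq> {}"
      using volatility_bounds_midpoint by blast
    moreover have "(real l / 2 ^ n + real (l + 1) / 2 ^ n) / 2 = real k / 2 ^ Suc n"
      using l by (simp add: field_simps)
    ultimately show ?thesis by metis
  qed
qed

lemma volatility_bounds_bdd_below: "bdd_below (volatility_bounds q)"
  using volatility_le_nonneg by (auto simp: volatility_bounds_def intro!: bdd_belowI[of _ 0])

text \<open>The least volatility, as a function of the distance from \<open>Atom 0\<close>, is
  midpoint convex wherever it exceeds the step size. The infimum need not be attained, so
  near-optimal witnesses are combined with an error e.\<close>

lemma Inf_volatility_bounds_midpoint: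
  assumes "volatility_bounds p \<noteq> {}" "volatility_bounds r \<noteq> {}" "p \<noteq> r"
  shows "Inf (volatility_bounds ((p + r) / 2))
    \<le> max (\<bar>p - r\<bar> / 2) ((Inf (volatility_bounds p) + Inf (volatility_bounds r)) / 2)"
proof (rule field_le_epsilon)
  fix e :: real assume "0 < e"
  then obtain u v where u: "u \<in> volatility_bounds p" "u < Inf (volatility_bounds p) + e"
    and v: "v \<in> volatility_bounds r" "v < Inf (volatility_bounds r) + e"
    using cInf_less_iff[OF assms(1) volatility_bounds_bdd_below]
      cInf_less_iff[OF assms(2) volatility_bounds_bdd_below] by (metis less_add_same_cancel1)
  have "Inf (volatility_bounds ((p + r) / 2)) \<le> max (\<bar>p - r\<bar> / 2) ((u + v) / 2)"
    by (intro cInf_lower volatility_bounds_midpoint u v assms volatility_bounds_bdd_below)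
  also have "\<dots> \<le> max (\<bar>p - r\<bar> / 2) ((Inf (volatility_bounds p) + Inf (volatility_bounds r)) / 2) + e"
    using u(2) v(2) \<open>0 < e\<close> by (simp add: max_def field_simps)
  finally show "Inf (volatility_bounds ((p + r) / 2))
    \<le> max (\<bar>p - r\<bar> / 2) ((Inf (volatility_bounds p) + Inf (volatility_bounds r)) / 2) + e" .
qed

text \<open>Suppose the maximum exceeds c and take the leftmost place where it is attained. It is
  interior, its left neighbour is strictly smaller and its right neighbour not larger, so the
  average of the neighbours is too small for \<open>mid\<close>.\<close>

lemma discrete_maximum_principle:
  fixes g :: "nat \<Rightarrow> real"
  assumes "g 0 \<le> c" "g N \<le> c"
    and mid: "\<And>k. 0 < k \<Longrightarrow> k < N \<Longrightarrow> g k \<le> max c ((g (k - 1) + g (k + 1)) / 2)"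
    and "k \<le> N"
  shows "g k \<le> c"
proof (rule ccontr)
  assume "\<not> g k \<le> c"
  define G where "G = Max (g ` {..N})"
  have G: "g i \<le> G" if "i \<le> N" for i
    using that unfolding G_def by (intro Max_ge) auto
  have "G \<in> g ` {..N}" unfolding G_def by (intro Max_in) auto
  then have ex: "\<exists>i. i \<le> N \<and> g i = G" by auto
  define l where "l = (LEAST i. i \<le> N \<and> g i = G)"
  have l: "l \<le> N" "g l = G" using LeastI_ex[OF ex] unfolding l_def by auto
  have "c < G" using G[OF \<open>k \<le> N\<close>] \<open>\<not> g k \<le> c\<close> by simp
  with l(2) assms(1,2) have "l \<noteq> 0" "l \<noteq> N" by (metis not_le)+
  then have "0 < l" "l < N" using l(1) by auto
  have "g (l - 1) \<noteq> G"
    using not_less_Least[of "l - 1" "\<lambda>i. i \<le> N \<and> g i = G", folded l_def] \<open>0 < l\<close> \<open>l < N\<close>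
    by auto
  then have "g (l - 1) < G" using G[of "l - 1"] l(1) by (simp add: order_less_le)
  moreover have "g (l + 1) \<le> G" using G[of "l + 1"] \<open>l < N\<close> by simp
  ultimately show False
    using mid[OF \<open>0 < l\<close> \<open>l < N\<close>] l(2) \<open>c < G\<close> unfolding le_max_iff_disj by argo
qed

text \<open>The model is simple random walk on a fine grid in [0, 1], stopped at the endpoints,
  where the atoms sit. Walks in V are finite, so the infimum over V together with the maximum
  principle replaces this unbounded walk.\<close>

lemma exists_small_volatility:
  assumes "\<epsilon> > 0"
  obtains y w where "y \<in> V_space 2" "V_dist (Atom 0) y = 1/2" "volatility_le y w" "w < \<epsilon>"
proof -
  obtain n where n: "(1/2) ^ n < \<epsilon>" using real_arch_pow_inv[OF assms, of "1/2"] by auto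
  \<comment> \<open>The mesh of the grid, which is also the step size from k to its neighbours k - 1
    and k + 1; the point 1/2 has numerator 2^n.\<close>
  define c :: real where "c = 1 / 2 ^ Suc n"
  define g where "g k = Inf (volatility_bounds (real k / 2 ^ Suc n))" for k
  have endpoint: "Inf (volatility_bounds (real i)) \<le> c" if "i < 2" for i
  proof -
    have "Inf (volatility_bounds (real i)) \<le> 0"
      by (intro cInf_lower zero_in_volatility_bounds that volatility_bounds_bdd_below)
    also have "0 \<le> c" by (simp add: c_def)
    finally show ?thesis .
  qed
  have "g (2 ^ n) \<le> c"
  proof (rule discrete_maximum_principle[of g c "2 ^ Suc n"])
    show "g 0 \<le> c" using endpoint[of 0] by (simp add: g_def)
    show "g (2 ^ Suc n) \<le> c" using endpoint[of 1] by (simp add: g_def)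
    fix k :: nat assume k: "0 < k" "k < 2 ^ Suc n"
    let ?p = "real (k - 1) / 2 ^ Suc n" and ?r = "real (k + 1) / 2 ^ Suc n"
    have mid: "(?p + ?r) / 2 = real k / 2 ^ Suc n" and step: "\<bar>?p - ?r\<bar> / 2 = c"
      using k by (simp_all add: c_def of_nat_diff field_simps)
    have "?p \<noteq> ?r" by (simp add: divide_cancel_right)
    then have "Inf (volatility_bounds ((?p + ?r) / 2))
        \<le> max (\<bar>?p - ?r\<bar> / 2) ((Inf (volatility_bounds ?p) + Inf (volatility_bounds ?r)) / 2)"
      using k by (intro Inf_volatility_bounds_midpoint volatility_bounds_dyadic_nonempty) auto
    then show "g k \<le> max c ((g (k - 1) + g (k + 1)) / 2)"
      unfolding g_def mid step .
  qed simp
  moreover have "real (2 ^ n) / 2 ^ Suc n = 1/2" by simp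
  ultimately have "Inf (volatility_bounds (1/2)) \<le> c" unfolding g_def by (simp only:)
  also have "c < \<epsilon>"
  proof -
    have "c = (1/2) * (1/2) ^ n" by (simp add: c_def power_one_over)
    also have "\<dots> \<le> (1/2) ^ n" by simp
    also note n
    finally show ?thesis .
  qed
  finally have "Inf (volatility_bounds (1/2)) < \<epsilon>" .
  moreover have "volatility_bounds (1/2) \<noteq> {}"
    using volatility_bounds_dyadic_nonempty[of 1 1] by simp
  ultimately obtain w where "w \<in> volatility_bounds (1/2)" "w < \<epsilon>"
    using cInf_less_iff[OF _ volatility_bounds_bdd_below] by blast
  then show thesis using that unfolding volatility_bounds_def by blast
qed

text \<open>For p = q = 1/2 the independent value p + q - 2 p q is 1/2. The sizes in the finite set
  R are bounded, so a point of small enough volatility loses at most 1/4 against all of R at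
  once.\<close>

lemma V_space_2_not_totally_bounded:
  assumes "finite R" "R \<subseteq> V_space 2" "\<And>x. x \<in> R \<Longrightarrow> V_dist (Atom 0) x = 1/2"
  shows "\<exists>y\<in>V_space 2. V_dist (Atom 0) y = 1/2 \<and> (\<forall>x\<in>R. 1/4 \<le> V_dist x y)"
proof -
  \<comment> \<open>Inserting 1 keeps \<open>Max\<close> defined and N positive even if R is
    empty.\<close>
  define N where "N = Max (insert 1 (size ` R))"
  have N: "1 \<le> N" "\<And>x. x \<in> R \<Longrightarrow> size x \<le> N"
    using assms(1) by (auto simp: N_def)
  have "1 / (4 * real N) > 0" using N(1) by simp
  then obtain y w where y: "y \<in> V_space 2" "V_dist (Atom 0) y = 1/2" "volatility_le y w"
    and w: "w < 1 / (4 * real N)" by (rule exists_small_volatility)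
  have "1/4 \<le> V_dist x y" if "x \<in> R" for x
  proof -
    have "real (size x) * w \<le> real N * (1 / (4 * real N))"
      using N(2)[OF that] w volatility_le_nonneg[OF y(3)] by (intro mult_mono) auto
    also have "\<dots> = 1/4" using N(1) by simp
    finally show ?thesis
      using V_dist_ge_independent[of x y w] assms(2,3) that y by auto
  qed
  then show ?thesis using y by blast
qed

text \<open>In a compact space every subset is covered by finitely many balls of radius 1/4 centred
  in the subset itself. The image of the points over two atoms at distance 1/2 from
  \<open>Atom 0\<close> violates this.\<close>

lemma V_metric_completion_not_compact:
  assumes compl: "metric_completion_of (V_metric j) X \<iota>" and "j > 1"
  shows "\<not> compact_space (mtopology_of X)"
proof
  assume "compact_space (mtopology_of X)"
  interpret X: Metric_space "mspace X" "mdist X" by simp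
  have V: "V_space 2 \<subseteq> V_space j" using \<open>j > 1\<close> by (intro V_space_mono) simp
  have \<iota>: "\<And>a. a \<in> V_space j \<Longrightarrow> \<iota> a \<in> mspace X"
    and iso: "\<And>a b. \<lbrakk>a \<in> V_space j; b \<in> V_space j\<rbrakk> \<Longrightarrow> mdist X (\<iota> a) (\<iota> b) = V_dist a b"
    using compl by (auto simp: metric_completion_of_def)
  let ?Y = "{y \<in> V_space 2. V_dist (Atom 0) y = 1/2}"
  have "X.mtotally_bounded (mspace X)"
    using \<open>compact_space (mtopology_of X)\<close> X.compactin_imp_mtotally_bounded
    by (simp add: compact_space_def mtopology_of_def)
  then have "X.mtotally_bounded (\<iota> ` ?Y)"
    by (rule X.mtotally_bounded_subset) (use V \<iota> in auto)
  then have "\<exists>K. finite K \<and> K \<subseteq> \<iota> ` ?Y \<and> \<iota> ` ?Y \<subseteq> (\<Union>x\<in>K. X.mball x (1/4))"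
    unfolding X.mtotally_bounded_def by simp
  then obtain K where K: "finite K" "K \<subseteq> \<iota> ` ?Y" "\<iota> ` ?Y \<subseteq> (\<Union>x\<in>K. X.mball x (1/4))" by blast
  then obtain R where R: "finite R" "R \<subseteq> ?Y" "K = \<iota> ` R"
    using finite_subset_image[OF K(1,2)] by blast
  have "\<exists>y\<in>V_space 2. V_dist (Atom 0) y = 1/2 \<and> (\<forall>x\<in>R. 1/4 \<le> V_dist x y)"
    using R(1,2) by (intro V_space_2_not_totally_bounded) auto
  then obtain y where y: "y \<in> ?Y" "\<And>x. x \<in> R \<Longrightarrow> 1/4 \<le> V_dist x y" by blast
  have "\<iota> y \<in> (\<Union>x\<in>K. X.mball x (1/4))" by (rule subsetD[OF K(3) imageI[OF y(1)]])
  then obtain z where z: "z \<in> K" "\<iota> y \<in> X.mball z (1/4)" by (rule UN_E)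
  then obtain x where x: "x \<in> R" "z = \<iota> x" unfolding R(3) by blast
  have "mdist X (\<iota> x) (\<iota> y) < 1/4" using z(2) x(2) by simp
  moreover have "x \<in> V_space j" "y \<in> V_space j" using x R(2) y(1) V by blast+
  ultimately show False using y(2)[OF x(1)] iso[of x y] by simp
qed

section \<open>The completion as a convex hull\<close>

lemma V_metric_completion_sigma_conv:
  assumes compl: "metric_completion_of (V_metric j) X \<iota>" and "bicombing X \<sigma>"
    and mid: "\<And>a b. \<lbrakk>a \<in> V_space j; b \<in> V_space j\<rbrakk> \<Longrightarrow> \<sigma> (\<iota> a) (\<iota> b) (1/2) = \<iota> (mpair a b)"
  shows "sigma_conv X \<sigma> (\<iota> ` Atom ` {0..<j}) = mspace X"
proof
  have \<iota>: "\<And>a. a \<in> V_space j \<Longrightarrow> \<iota> a \<in> mspace X"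
    using compl by (auto simp: metric_completion_of_def)
  have "\<sigma> x y t \<in> mspace X" if "x \<in> mspace X" "y \<in> mspace X" "t \<in> {0..1}" for x y t
    using \<open>bicombing X \<sigma>\<close> that unfolding bicombing_def geodesic_def by blast
  then have "sigma_convex X \<sigma> (mspace X)"
    unfolding sigma_convex_def by blast
  moreover have "closedin (mtopology_of X) (mspace X)"
    by (metis closedin_topspace topspace_mtopology_of)
  moreover have "\<iota> ` Atom ` {0..<j} \<subseteq> mspace X"
    using \<iota> Atom_in_V_space by auto
  ultimately show "sigma_conv X \<sigma> (\<iota> ` Atom ` {0..<j}) \<subseteq> mspace X"
    unfolding sigma_conv_def by blast
  have "mspace X \<subseteq> C"
    if C: "closedin (mtopology_of X) C" "sigma_convex X \<sigma> C" "\<iota> ` Atom ` {0..<j} \<subseteq> C" for C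
  proof -
    \<comment> \<open>Each stage consists of midpoints of the previous one, and
      \<open>\<sigma>\<close> passes through them at time 1/2.\<close>
    have "\<iota> ` V_stage j n \<subseteq> C" for n
    proof (induction n)
      case 0
      then show ?case using C(3) by simp
    next
      case (Suc n)
      have "\<iota> (mpair a b) \<in> C" if ab: "a \<in> V_stage j n" "b \<in> V_stage j n" for a b
      proof -
        have "\<iota> a \<in> C" "\<iota> b \<in> C" using Suc.IH ab by auto
        then have "\<sigma> (\<iota> a) (\<iota> b) (1/2) \<in> C"
          using C(2) unfolding sigma_convex_def by (fastforce simp: image_subset_iff)
        moreover have "a \<in> V_space j" "b \<in> V_space j" using ab unfolding V_space_def by blast+
        ultimately show ?thesis using mid by simp
      qed
      then show ?case by auto
    qed
    then have "\<iota> ` V_space j \<subseteq> C" unfolding V_space_def by blast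
    then have "mtopology_of X closure_of (\<iota> ` V_space j) \<subseteq> C"
      using C(1) by (simp add: closure_of_minimal)
    then show ?thesis using compl by (simp add: metric_completion_of_def)
  qed
  then show "mspace X \<subseteq> sigma_conv X \<sigma> (\<iota> ` Atom ` {0..<j})"
    unfolding sigma_conv_def by blast
qed

theorem theorem6p1:
  fixes j :: nat and X :: "'a metric" and \<iota> :: "elt \<Rightarrow> 'a"
  assumes "j > 0"
    and "metric_completion_of (V_metric j) X \<iota>"
  shows "(\<exists>\<sigma>. bicombing X \<sigma> \<and> conical X \<sigma> \<and>
            (\<exists>A. A \<subseteq> mspace X \<and> finite A \<and> card A = j \<and> sigma_conv X \<sigma> A = mspace X))
         \<and> (j > 1 \<longrightarrow> \<not> compact_space (mtopology_of X))"
proof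
  interpret X: Metric_space "mspace X" "mdist X" by simp
  interpret V: conical_midpoints "V_space j" V_dist mpair by (rule conical_midpoints_V)
  have \<iota>: "\<And>a. a \<in> V_space j \<Longrightarrow> \<iota> a \<in> mspace X"
    and iso: "\<And>a b. \<lbrakk>a \<in> V_space j; b \<in> V_space j\<rbrakk> \<Longrightarrow> mdist X (\<iota> a) (\<iota> b) = V_dist a b"
    using assms(2) by (auto simp: metric_completion_of_def)
  obtain \<sigma> where \<sigma>: "bicombing X \<sigma>" "conical X \<sigma>"
    and mid: "\<And>a b. \<lbrakk>a \<in> V_space j; b \<in> V_space j\<rbrakk> \<Longrightarrow> \<sigma> (\<iota> a) (\<iota> b) (1/2) = \<iota> (mpair a b)"
    using V.completion_conical_bicombing assms(2) unfolding V_metric_def by metis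
  let ?A = "\<iota> ` Atom ` {0..<j}"
  \<comment> \<open>Distinct atoms have distance 1, so their images stay distinct and
    \<open>?A\<close> has exactly j points.\<close>
  have "inj_on (\<lambda>i. \<iota> (Atom i)) {0..<j}"
  proof (rule inj_onI)
    fix i k assume ik: "i \<in> {0..<j}" "k \<in> {0..<j}" "\<iota> (Atom i) = \<iota> (Atom k)"
    then have "V_dist (Atom i) (Atom k) = 0"
      using iso[of "Atom i" "Atom k"] \<iota> Atom_in_V_space by simp
    then show "i = k" by (simp split: if_splits)
  qed
  then have "card ?A = j" by (simp add: image_image card_image)
  moreover have "?A \<subseteq> mspace X" using \<iota> Atom_in_V_space by auto
  moreover have "sigma_conv X \<sigma> ?A = mspace X"
    by (rule V_metric_completion_sigma_conv[OF assms(2) \<sigma>(1) mid])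
  ultimately show "\<exists>\<sigma>. bicombing X \<sigma> \<and> conical X \<sigma> \<and>
      (\<exists>A. A \<subseteq> mspace X \<and> finite A \<and> card A = j \<and> sigma_conv X \<sigma> A = mspace X)"
    using \<sigma> by (intro exI[of _ \<sigma>] conjI exI[of _ ?A]) auto
qed (use V_metric_completion_not_compact[OF assms(2)] in blast)

end
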